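(* Let $m\ge 2$ be an integer. (1) For $n\ge 0$ let $\widetilde{p_m}(n,t):=t^{-s_m(n)}p_m(n,t)$. Then $\widetilde{p_m}(n,t)\in\mathbb{N}_0[t^{m-1}]$, i.e. it is a polynomial in $t^{m-1}$ with nonnegative integer coefficients. (2) Let $P_m(n,q):=\widetilde{p_m}(mn,q^{1/(m-1)})$. Then $P_m(n,q)\in\mathbb{N}_0[q]$, $P_m(k,q)=\frac{q^{k+1}-1}{q-1}$ for $k\in\{0,\ldots,m-1\}$, and for $n\ge 2$ \[ P_m(n,q)=q^{1+\nu_m(n)}P_m(n-1,q)+P_m\left(\left\lfloor \tfrac{n}{m}\right\rfloor,q\right), \] where $\nu_m(n)$ is the largest integer $e$ with $m^e\mid n$.
   Context: The $m$-ary partition polynomials $p_m(n,t)$ are defined by the power series expansion $\prod_{j=0}^{\infty}\frac{1}{1-tq^{m^j}}=\sum_{n=0}^{\infty}p_m(n,t)q^n$. $s_m(n)$ denotes the sum of the digits of $n$ in base $m$. *)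

theory Defs
  imports "HOL-Analysis.Analysis" "HOL-Computational_Algebra.Computational_Algebra"
    "HOL-Library.Poly_Mapping"
begin

text \<open>
  The factor \<open>1 / (1 - t q^(m^j))\<close>, a power series in \<open>q\<close> over \<open>\<int>[t]\<close>. As the coefficient ring is
  not a field, the inverse is \<open>fps_right_inverse\<close>, given the inverse \<open>1\<close> of the
  constant coefficient; see \<open>mary_factor_inverse\<close>.
\<close>

definition mary_factor :: "nat \<Rightarrow> nat \<Rightarrow> int poly fps" where
  "mary_factor m j = fps_right_inverse (1 - fps_const [:0, 1:] * fps_X ^ (m ^ j)) 1"

text \<open>The infinite product is taken in the \<open>q\<close>-adic topology of \<^typ>\<open>int poly fps\<close>.\<close>

definition mary_poly :: "nat \<Rightarrow> nat \<Rightarrow> int poly" where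
  "mary_poly m n = fps_nth (prodinf (mary_factor m)) n"

text \<open>For \<open>m \<ge> 2\<close> the digits at positions \<open>i > n\<close> are zero.\<close>

definition digit_sum :: "nat \<Rightarrow> nat \<Rightarrow> nat" where
  "digit_sum m n = (\<Sum>i\<le>n. n div m ^ i mod m)"

text \<open>
  Negative powers and roots of the indeterminate live in the ring of finite \<open>\<int>\<close>-linear combinations
  of powers with rational exponents. It is an integral domain containing \<open>\<int>[t]\<close>.
\<close>

type_synonym puiseux = "rat \<Rightarrow>\<^sub>0 int"

definition ipow :: "rat \<Rightarrow> puiseux" where
  "ipow r = Poly_Mapping.single r 1"

text \<open>Substitution of the \<open>r\<close>-th power of the indeterminate for the indeterminate.\<close>

definition subst_ipow :: "rat \<Rightarrow> puiseux \<Rightarrow> puiseux" where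
  "subst_ipow r f =
     (\<Sum>e\<in>Poly_Mapping.keys f. Poly_Mapping.single (r * e) (Poly_Mapping.lookup f e))"

definition mary_tilde :: "nat \<Rightarrow> nat \<Rightarrow> puiseux" where
  "mary_tilde m n =
     ipow (- of_nat (digit_sum m n)) * poly (map_poly of_int (mary_poly m n)) (ipow 1)"

definition mary_P :: "nat \<Rightarrow> nat \<Rightarrow> puiseux" where
  "mary_P m n = subst_ipow (1 / of_nat (m - 1)) (mary_tilde m (m * n))"

text \<open>The set \<open>\<nat>\<^sub>0[x]\<close>.\<close>

definition nat_polys_in :: "'a :: comm_semiring_1 \<Rightarrow> 'a set" where
  "nat_polys_in x = range (\<lambda>Q :: nat poly. poly (map_poly of_nat Q) x)"

lemma mary_factor_inverse:
  assumes "m \<ge> 2"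
  shows "(1 - fps_const [:0, 1:] * fps_X ^ (m ^ j)) * mary_factor m j = 1"
  unfolding mary_factor_def using assms by (intro fps_right_inverse) simp

lemma mary_factor_has_prod:
  assumes m: "m \<ge> 2"
  shows "mary_factor m has_prod prodinf (mary_factor m)"
proof -
  define S where "S N = (\<Prod>j\<le>N. mary_factor m j)" for N
  have nth_mult: "(F * mary_factor m j) $ k = F $ k" if "k < m ^ j" for F j k
  proof -
    have "mary_factor m j = 1 + fps_const [:0, 1:] * fps_X ^ (m ^ j) * mary_factor m j"
      using mary_factor_inverse[OF m, of j] by (simp add: algebra_simps)
    hence "F * mary_factor m j =
        F * (1 + fps_const [:0, 1:] * fps_X ^ (m ^ j) * mary_factor m j)"
      by (rule arg_cong)
    hence "F * mary_factor m j =
        F + fps_X ^ (m ^ j) * (fps_const [:0, 1:] * mary_factor m j * F)"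
      by (simp only: algebra_simps mult_1_right)
    hence "(F * mary_factor m j) $ k =
        F $ k + (fps_X ^ (m ^ j) * (fps_const [:0, 1:] * mary_factor m j * F)) $ k"
      by simp
    thus ?thesis using that by (simp add: fps_X_power_mult_nth)
  qed
  have stable: "S (k + d) $ k = S k $ k" for k d
  proof (induction d)
    case (Suc d)
    have "k < 2 ^ (k + Suc d)"
      by (meson le_add1 le_less_trans less_exp power_increasing one_le_numeral order_less_le_trans)
    also have "\<dots> \<le> m ^ (k + Suc d)"
      using m by (rule power_mono) simp
    finally have "(S (k + d) * mary_factor m (k + Suc d)) $ k = S (k + d) $ k"
      by (rule nth_mult)
    thus ?case using Suc by (simp add: S_def)
  qed simp
  define L where "L = Abs_fps (\<lambda>k. S k $ k)"
  have "S \<longlonglongrightarrow> L"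
    unfolding tendsto_fps_iff L_def
  proof (intro allI)
    fix k
    show "\<forall>\<^sub>F N in sequentially. S N $ k = Abs_fps (\<lambda>k. S k $ k) $ k"
      using stable[of k] by (intro eventually_sequentiallyI[of k]) (auto simp: le_iff_add)
  qed
  moreover have "L $ 0 \<noteq> 0"
    by (simp add: L_def S_def mary_factor_def)
  hence "L \<noteq> 0" by auto
  ultimately have "mary_factor m has_prod L"
    by (simp add: has_prod_def raw_has_prod_def S_def[abs_def])
  moreover from this have "L = prodinf (mary_factor m)" by (rule has_prod_unique)
  ultimately show ?thesis by simp
qed

end

theory Submission
  imports Defs
begin

text \<open>
  The generating function satisfies \<open>(1 - t q) F(q) = F(q^m)\<close>, that is,
  \<open>p(n) = t p(n - 1) + [m dvd n] p(n / m)\<close>. Going through a full block of residues modulo \<open>m\<close>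
  gives \<open>p(m n) = t^m p(m (n - 1)) + p(n)\<close> and \<open>p(n) = t^(n mod m) p(m \<lfloor>n / m\<rfloor>)\<close>.
  Dividing by powers of \<open>t\<close> and using \<open>s(n) + (m - 1) \<nu>(n) = s(n - 1) + 1\<close> turns this into a
  recurrence whose only coefficients are powers of \<open>t^(m - 1)\<close>.
\<close>

section \<open>The functional equation of the generating function\<close>

lemma mary_factor_Suc:
  assumes "m \<ge> 2"
  shows "mary_factor m (Suc j) = mary_factor m j oo fps_X ^ m"
proof -
  define c where "c = (fps_const [:0, 1:] :: int poly fps)"
  have X0: "(fps_X ^ m :: int poly fps) $ 0 = 0" using assms by simp
  have "(1 - c * fps_X ^ (m ^ j)) oo fps_X ^ m = 1 - c * fps_X ^ (m ^ Suc j)"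
    by (simp add: c_def fps_compose_sub_distrib fps_compose_mult_distrib[OF X0]
        fps_X_power_compose[OF X0] flip: power_mult)
  moreover have "((1 - c * fps_X ^ (m ^ j)) * mary_factor m j) oo fps_X ^ m = 1"
    using mary_factor_inverse[OF assms, of j] by (simp add: c_def)
  ultimately have "(1 - c * fps_X ^ (m ^ Suc j)) * (mary_factor m j oo fps_X ^ m) = 1"
    by (simp add: fps_compose_mult_distrib[OF X0])
  moreover have "(1 - c * fps_X ^ (m ^ Suc j)) * mary_factor m (Suc j) = 1"
    using mary_factor_inverse[OF assms, of "Suc j"] by (simp add: c_def)
  \<comment> \<open>Substituting q^m for q preserves products, so both series are inverse to 1 - t
    q^(m^(j+1)). An inverse in an integral domain is unique.\<close>
  ultimately show ?thesis
    by (metis mult_left_cancel mult_zero_left zero_neq_one)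
qed

text \<open>The truncated products already satisfy (1 - t q) S_{N+1}(q) = S_N(q^m). Comparing
  coefficients there involves finite products only, and each coefficient of S_N is eventually
  constant, so the relation passes to the limit.\<close>

lemma mary_poly_rec:
  assumes m: "m \<ge> 2"
  shows "mary_poly m n = (if n = 0 then 0 else pCons 0 (mary_poly m (n - 1)))
           + (if m dvd n then mary_poly m (n div m) else 0)"
    and "mary_poly m 0 = 1"
proof -
  define S where "S N = (\<Prod>j\<le>N. mary_factor m j)" for N
  \<comment> \<open>\<open>has_prod\<close> allows zero factors to be skipped; excluding them
    identifies \<open>prodinf\<close> with the limit of the partial products starting at 0.\<close>
  have "mary_factor m j \<noteq> 0" for j
    using mary_factor_inverse[OF m, of j] by auto
  hence "S \<longlonglongrightarrow> prodinf (mary_factor m)"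
    using mary_factor_has_prod[OF m]
    by (auto simp: has_prod_def raw_has_prod_def S_def[abs_def])
  hence S_nth: "\<forall>\<^sub>F N in sequentially. S N $ k = mary_poly m k" for k
    by (simp add: tendsto_fps_iff mary_poly_def)
  have X0: "(fps_X ^ m :: int poly fps) $ 0 = 0" using m by simp
  have S_Suc: "S (Suc N) = mary_factor m 0 * (S N oo fps_X ^ m)" for N
    unfolding S_def
    by (subst prod.atMost_Suc_shift)
       (simp add: fps_compose_prod_distrib[OF X0] mary_factor_Suc[OF m])
  have S_rec: "(1 - fps_const [:0, 1:] * fps_X) * S (Suc N) = S N oo fps_X ^ m" for N
    using mary_factor_inverse[OF m, of 0] by (simp add: S_Suc flip: mult.assoc)
  have nth_rec: "S (Suc N) $ n = (if n = 0 then 0 else pCons 0 (S (Suc N) $ (n - 1)))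
           + (if m dvd n then S N $ (n div m) else 0)" for N
    using arg_cong[OF S_rec[of N], of "\<lambda>F. F $ n"] m
    by (simp add: fps_nth_compose_X_power left_diff_distrib mult.assoc algebra_simps split: if_splits)
  have S_Suc_nth: "\<forall>\<^sub>F N in sequentially. S (Suc N) $ k = mary_poly m k" for k
    using S_nth[of k] by (subst eventually_sequentially_Suc)
  have "\<forall>\<^sub>F N in sequentially. mary_poly m n
      = (if n = 0 then 0 else pCons 0 (mary_poly m (n - 1)))
           + (if m dvd n then mary_poly m (n div m) else 0)"
    using S_nth[of "n div m"] S_Suc_nth[of n] S_Suc_nth[of "n - 1"]
  proof eventually_elim
    case (elim N)
    show ?case using nth_rec[of N] by (simp only: elim)
  qed
  thus "mary_poly m n = (if n = 0 then 0 else pCons 0 (mary_poly m (n - 1)))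
           + (if m dvd n then mary_poly m (n div m) else 0)" by simp
  have "S N $ 0 = 1" for N
    by (induction N) (simp_all add: S_def mary_factor_def)
  thus "mary_poly m 0 = 1"
    using S_nth[of 0] by simp
qed

section \<open>Digit sums\<close>

lemma digit_sum_rec:
  assumes m: "m \<ge> 2"
  shows "digit_sum m n = n mod m + digit_sum m (n div m)"
proof (cases n)
  case (Suc k)
  have le: "n div m \<le> k"
    using Suc m by (metis div_less_dividend less_Suc_eq_le less_le_trans one_less_numeral_iff
        semiring_norm(76) zero_less_Suc)
  \<comment> \<open>Splitting off the last digit leaves a sum up to n - 1, while the definition at n
    div m stops at n div m. The terms in between vanish because i < m^i.\<close>
  have "(\<Sum>i\<le>k. n div m div m ^ i mod m) = (\<Sum>i\<le>n div m. n div m div m ^ i mod m)"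
  proof (rule sum.mono_neutral_right)
    show "\<forall>i\<in>{..k} - {..n div m}. n div m div m ^ i mod m = 0"
    proof
      fix i assume "i \<in> {..k} - {..n div m}"
      hence "n div m < i" by simp
      also have "i < m ^ i" using m by (intro power_gt_expt) simp
      finally show "n div m div m ^ i mod m = 0" by simp
    qed
  qed (use le in auto)
  thus ?thesis
    unfolding digit_sum_def using Suc
    by (simp add: sum.atMost_Suc_shift div_mult2_eq del: sum.atMost_Suc)
qed (simp add: digit_sum_def)

lemma digit_sum_0 [simp]: "digit_sum m 0 = 0"
  by (simp add: digit_sum_def)

text \<open>Subtracting 1 turns the trailing zeros of n, \<open>multiplicity m n\<close> in number,
  into digits m - 1 and lowers the next digit by one. The induction strips one trailing zero at a
  time.\<close>

lemma digit_sum_pred: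
  assumes m: "m \<ge> 2"
  shows "n > 0 \<Longrightarrow> digit_sum m n + (m - 1) * multiplicity m n = digit_sum m (n - 1) + 1"
proof (induction n rule: less_induct)
  case (less n)
  show ?case
  proof (cases "m dvd n")
    case True
    then obtain k where n: "n = m * k" by blast
    with less.prems have k: "k > 0" by simp
    with n m have "k < n" by simp
    note IH = less.IH[OF this k]
    have "n - 1 = (m - 1) + m * (k - 1)"
      using n k m by (cases k) (auto simp: algebra_simps)
    moreover have "(r + m * (k - 1)) mod m = r \<and> (r + m * (k - 1)) div m = k - 1" if "r < m" for r
      using that by simp
    note this[of "m - 1"]
    ultimately have "digit_sum m (n - 1) = (m - 1) + digit_sum m (k - 1)"
      using digit_sum_rec[OF m, of "n - 1"] m by simp
    moreover have "digit_sum m n = digit_sum m k"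
      using digit_sum_rec[OF m, of n] n m by simp
    moreover have "multiplicity m n = Suc (multiplicity m k)"
      unfolding n using m k by (intro multiplicity_times_same) auto
    ultimately show ?thesis using IH by simp
  next
    case False
    hence "n mod m \<noteq> 0" by (simp add: dvd_eq_mod_eq_0)
    moreover from this obtain r where r: "n mod m = Suc r" using not0_implies_Suc by blast
    have n: "n - 1 = r + m * (n div m)"
      using r mult_div_mod_eq[of m n] by simp
    have "r < m" using r m by (metis Suc_lessD mod_less_divisor pos2 less_le_trans)
    hence "digit_sum m (n - 1) = r + digit_sum m (n div m)"
      unfolding n using digit_sum_rec[OF m, of "r + m * (n div m)"] by simp
    thus ?thesis
      using digit_sum_rec[OF m, of n] r False by (simp add: not_dvd_imp_multiplicity_0)
  qed
qed

section \<open>Rational powers of the indeterminate and their substitution\<close>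

lemma ipow_add: "ipow (a + b) = ipow a * ipow b"
  by (simp add: ipow_def mult_single)

lemma ipow_0 [simp]: "ipow 0 = 1"
  by (simp add: ipow_def)

lemma ipow_power: "ipow a ^ k = ipow (of_nat k * a)"
  by (induction k) (simp_all add: ipow_add algebra_simps)

lemma ipow_1_neq_1: "ipow 1 \<noteq> 1"
proof
  assume "ipow 1 = 1"
  hence "Poly_Mapping.lookup (ipow 1) 1 = Poly_Mapping.lookup (1 :: puiseux) 1"
    by (rule arg_cong)
  thus False by (simp add: ipow_def lookup_one)
qed

text \<open>Cancellation can make the keys of f + g fewer than those of f and g together; summing
  over one common index set gives additivity.\<close>

lemma subst_ipow_superset:
  assumes "finite A" "Poly_Mapping.keys f \<subseteq> A"
  shows "subst_ipow r f = (\<Sum>e\<in>A. Poly_Mapping.single (r * e) (Poly_Mapping.lookup f e))"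
  unfolding subst_ipow_def using assms
  by (intro sum.mono_neutral_left) (auto simp: in_keys_iff)

lemma subst_ipow_add: "subst_ipow r (f + g) = subst_ipow r f + subst_ipow r g"
proof -
  let ?A = "Poly_Mapping.keys f \<union> Poly_Mapping.keys g"
  have "subst_ipow r h = (\<Sum>e\<in>?A. Poly_Mapping.single (r * e) (Poly_Mapping.lookup h e))"
    if "h \<in> {f, g, f + g}" for h
    using that keys_add[of f g] by (intro subst_ipow_superset) auto
  thus ?thesis by (simp add: lookup_add single_add sum.distrib)
qed

lemma subst_ipow_sum: "subst_ipow r (\<Sum>i\<in>A. f i) = (\<Sum>i\<in>A. subst_ipow r (f i))"
  by (induction A rule: infinite_finite_induct)
     (simp_all add: subst_ipow_add, simp_all add: subst_ipow_def)

lemma subst_ipow_single: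
  "subst_ipow r (Poly_Mapping.single e c) = Poly_Mapping.single (r * e) c"
  by (subst subst_ipow_superset[of "{e}"]) auto

text \<open>In this form the substitution can be carried out monomial by monomial.\<close>

lemma poly_of_nat_ipow:
  "poly (map_poly of_nat Q) (ipow a) =
     (\<Sum>i\<le>degree Q. Poly_Mapping.single (of_nat i * a) (of_nat (coeff Q i)))"
proof -
  have single: "of_nat c * ipow b = Poly_Mapping.single b (of_nat c)" for c b
    by (induction c) (simp_all add: ipow_def distrib_right single_add)
  have "poly (map_poly of_nat Q) (ipow a) = (\<Sum>i\<le>degree Q. of_nat (coeff Q i) * ipow a ^ i)"
    by (simp add: poly_altdef degree_map_poly coeff_map_poly)
  thus ?thesis by (simp add: ipow_power single)
qed

lemma subst_ipow_poly:
  "subst_ipow r (poly (map_poly of_nat Q) (ipow a)) = poly (map_poly of_nat Q) (ipow (r * a))"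
  by (simp add: poly_of_nat_ipow subst_ipow_sum subst_ipow_single algebra_simps)

section \<open>Recurrences for the partition polynomials and their normalisation\<close>

context
  fixes m :: nat
  assumes m: "m \<ge> 2"
begin

definition mary_value :: "nat \<Rightarrow> puiseux" where
  "mary_value n = poly (map_poly of_int (mary_poly m n)) (ipow 1)"

lemma mary_tilde_eq: "mary_tilde m n = ipow (- of_nat (digit_sum m n)) * mary_value n"
  by (simp add: mary_tilde_def mary_value_def)

lemma mary_value_rec:
  "mary_value n = (if n = 0 then 0 else ipow 1 * mary_value (n - 1))
      + (if m dvd n then mary_value (n div m) else 0)"
proof -
  have add: "map_poly of_int (p + q) = (map_poly of_int p + map_poly of_int q :: puiseux poly)"
    for p q by (rule poly_eqI) (simp add: coeff_map_poly)
  show ?thesis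
    unfolding mary_value_def
    by (subst mary_poly_rec(1)[OF m]) (simp add: add map_poly_pCons)
qed

text \<open>At indices not divisible by m only the first term of the recurrence survives, so each
  step contributes one factor t.\<close>

lemma mary_value_add:
  "r < m \<Longrightarrow> mary_value (m * k + r) = ipow (of_nat r) * mary_value (m * k)"
proof (induction r)
  case (Suc r)
  have "\<not> m dvd m * k + Suc r"
    using Suc.prems by (simp add: dvd_add_right_iff nat_dvd_not_less del: add_Suc_right)
  thus ?case
    using Suc mary_value_rec[of "m * k + Suc r"] by (simp add: ipow_add)
qed simp

text \<open>One step of the recurrence leads from m n to m n - 1 = m (n - 1) + (m - 1), and m - 1
  further steps lead to m (n - 1), giving t^m in total.\<close>

lemma mary_value_mult:
  assumes "n > 0"
  shows "mary_value (m * n) = ipow (of_nat m) * mary_value (m * (n - 1)) + mary_value n"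
proof -
  have eq: "m * n - 1 = m * (n - 1) + (m - 1)"
    using assms m by (cases n) (auto simp: algebra_simps)
  have "ipow 1 * ipow (of_nat (m - 1)) = ipow (of_nat m)"
    using m by (simp flip: ipow_add add: of_nat_diff)
  thus ?thesis
    using mary_value_rec[of "m * n"] mary_value_add[of "m - 1" "n - 1"] assms m
    by (simp only: eq flip: mult.assoc) simp
qed

text \<open>The factor t^(n mod m) is cancelled by the contribution of the last digit to the digit
  sum. Claims about all indices thus reduce to multiples of m.\<close>

lemma mary_tilde_div: "mary_tilde m n = mary_tilde m (m * (n div m))"
proof -
  have "mary_value n = ipow (of_nat (n mod m)) * mary_value (m * (n div m))"
    using mary_value_add[of "n mod m" "n div m"] m by simp
  moreover have "digit_sum m n = n mod m + digit_sum m (m * (n div m))"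
    using digit_sum_rec[OF m, of n] digit_sum_rec[OF m, of "m * (n div m)"] m by simp
  ultimately show ?thesis
    by (simp add: mary_tilde_eq flip: mult.assoc ipow_add)
qed

lemma mary_tilde_mult:
  assumes "n > 0"
  shows "mary_tilde m (m * n) =
    ipow (of_nat (m - 1)) ^ (1 + multiplicity m n) * mary_tilde m (m * (n - 1)) + mary_tilde m n"
proof -
  have s: "digit_sum m (m * k) = digit_sum m k" for k
    using digit_sum_rec[OF m, of "m * k"] m by simp
  have "of_nat (digit_sum m n + (m - 1) * multiplicity m n) = (of_nat (digit_sum m (n - 1) + 1) :: rat)"
    using digit_sum_pred[OF m assms] by (rule arg_cong)
  hence "of_nat (digit_sum m n) + (of_nat m - 1) * of_nat (multiplicity m n) =
      (of_nat (digit_sum m (n - 1)) + 1 :: rat)"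
    using m by (simp only: of_nat_add of_nat_mult of_nat_diff of_nat_1)
  \<comment> \<open>Here \<open>digit_sum_pred\<close> makes the exponent a multiple of m - 1, up to
    the normalising exponent of the index n - 1.\<close>
  hence "- of_nat (digit_sum m n) + of_nat m =
      of_nat (1 + multiplicity m n) * of_nat (m - 1) + (- of_nat (digit_sum m (n - 1)) :: rat)"
    using m by (simp add: of_nat_diff algebra_simps)
  hence "ipow (- of_nat (digit_sum m n)) * ipow (of_nat m) =
      ipow (of_nat (m - 1)) ^ (1 + multiplicity m n) * ipow (- of_nat (digit_sum m (n - 1)))"
    by (simp only: ipow_power flip: ipow_add)
  thus ?thesis
    by (simp only: mary_tilde_eq s mary_value_mult[OF assms] distrib_left flip: mult.assoc)
qed

lemma mary_tilde_0: "mary_tilde m 0 = 1"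
  by (simp add: mary_tilde_def mary_poly_rec(2)[OF m])

end

section \<open>The polynomial with natural coefficients behind \<open>mary_tilde\<close> and
  \<open>mary_P\<close>\<close>

function reduced_poly :: "nat \<Rightarrow> nat \<Rightarrow> nat poly" where
  "reduced_poly m n = (if m < 2 \<or> n = 0 then 1 else
     monom 1 (1 + multiplicity m n) * reduced_poly m (n - 1) + reduced_poly m (n div m))"
  by auto
text \<open>The guard \<open>m < 2\<close> excludes m = 1, where n div m would not decrease.\<close>

termination by (relation "Wellfounded.measure snd") auto

declare reduced_poly.simps [simp del]

text \<open>The point x is left general because both t^(m-1) and q are inserted later.\<close>

lemma poly_reduced_poly_rec:
  fixes x :: "'a :: comm_semiring_1"
  assumes "m \<ge> 2" "n > 0"
  shows "poly (map_poly of_nat (reduced_poly m n)) x =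
    x ^ (1 + multiplicity m n) * poly (map_poly of_nat (reduced_poly m (n - 1))) x
      + poly (map_poly of_nat (reduced_poly m (n div m))) x"
proof -
  have add: "map_poly of_nat (p + q) = (map_poly of_nat p + map_poly of_nat q :: 'a poly)" for p q
    by (rule poly_eqI) (simp add: coeff_map_poly)
  have mult: "map_poly of_nat (monom 1 k * p) = (monom 1 k * map_poly of_nat p :: 'a poly)" for k p
    by (rule poly_eqI) (simp add: coeff_map_poly coeff_monom_mult)
  show ?thesis
    using assms by (subst reduced_poly.simps) (simp add: add mult poly_monom del: One_nat_def)
qed

lemma poly_reduced_poly_0 [simp]:
  "poly (map_poly of_nat (reduced_poly m 0)) (x :: 'a :: comm_semiring_1) = 1"
  by (simp add: reduced_poly.simps)

text \<open>Both sides obey the same recurrence: \<open>mary_tilde_div\<close> moves the last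
  summand of \<open>mary_tilde_mult\<close> to the index m (n div m), where the induction hypothesis
  applies.\<close>

lemma mary_tilde_mult_eq_poly:
  assumes m: "m \<ge> 2"
  shows "mary_tilde m (m * n) = poly (map_poly of_nat (reduced_poly m n)) (ipow (of_nat (m - 1)))"
proof (induction n rule: less_induct)
  case (less n)
  show ?case
  proof (cases "n = 0")
    case False
    moreover from this m have "n div m < n" by simp
    ultimately show ?thesis
      using less.IH[of "n - 1"] less.IH[of "n div m"] mary_tilde_mult[OF m, of n]
        mary_tilde_div[OF m, of n] poly_reduced_poly_rec[OF m, of n "ipow (of_nat (m - 1))"]
      by simp
  qed (simp add: mary_tilde_0[OF m])
qed

lemma mary_P_eq_poly:
  assumes m: "m \<ge> 2"
  shows "mary_P m n = poly (map_poly of_nat (reduced_poly m n)) (ipow 1)"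
  using m by (simp add: mary_P_def mary_tilde_mult_eq_poly[OF m] subst_ipow_poly)

text \<open>The range includes n = 1, where the geometric sums start.\<close>

lemma mary_P_rec:
  assumes "m \<ge> 2" "n > 0"
  shows "mary_P m n = ipow 1 ^ (1 + multiplicity m n) * mary_P m (n - 1) + mary_P m (n div m)"
  using poly_reduced_poly_rec[OF assms] by (simp add: mary_P_eq_poly[OF assms(1)])

text \<open>For 0 < k < m both the valuation of k and k div m are 0, so the recurrence becomes the
  Horner step P(k) = q P(k-1) + 1. Clearing the denominator keeps the identity inside
  \<open>puiseux\<close>.\<close>

lemma mary_P_geometric:
  assumes m: "m \<ge> 2"
  shows "k < m \<Longrightarrow> mary_P m k * (ipow 1 - 1) = ipow 1 ^ (k + 1) - 1"
proof (induction k)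
  case 0
  thus ?case by (simp add: mary_P_eq_poly[OF m])
next
  case (Suc k)
  have "multiplicity m (Suc k) = 0"
    using Suc.prems by (intro not_dvd_imp_multiplicity_0) (auto dest: dvd_imp_le)
  hence "mary_P m (Suc k) = ipow 1 * mary_P m k + 1"
    using mary_P_rec[OF m, of "Suc k"] Suc.prems by (simp add: mary_P_eq_poly[OF m, of 0])
  hence "mary_P m (Suc k) * (ipow 1 - 1) = ipow 1 * (mary_P m k * (ipow 1 - 1)) + (ipow 1 - 1)"
    by (simp add: algebra_simps)
  also have "mary_P m k * (ipow 1 - 1) = ipow 1 ^ (k + 1) - 1"
    using Suc by simp
  finally show ?case by (simp add: algebra_simps)
qed

theorem theorem4p5:
  fixes m :: nat
  assumes "m \<ge> 2"
  shows "(\<forall>n. mary_tilde m n \<in> nat_polys_in (ipow 1 ^ (m - 1))) \<and>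
    (\<forall>n. mary_P m n \<in> nat_polys_in (ipow 1)) \<and>
    (\<forall>k \<in> {0..m - 1}.
       Fraction_Field.Fract (mary_P m k) 1 =
       Fraction_Field.Fract (ipow 1 ^ (k + 1) - 1) (ipow 1 - 1)) \<and>
    (\<forall>n \<ge> 2. mary_P m n =
       ipow 1 ^ (1 + multiplicity m n) * mary_P m (n - 1) + mary_P m (n div m))"
proof (intro conjI allI ballI impI)
  fix n
  show "mary_tilde m n \<in> nat_polys_in (ipow 1 ^ (m - 1))"
    unfolding nat_polys_in_def mary_tilde_div[OF assms, of n] mary_tilde_mult_eq_poly[OF assms]
    by (simp add: ipow_power)
next
  fix n
  show "mary_P m n \<in> nat_polys_in (ipow 1)"
    by (simp add: nat_polys_in_def mary_P_eq_poly[OF assms])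
next
  fix k assume "k \<in> {0..m - 1}"
  hence "k < m" using assms by auto
  \<comment> \<open>Equality of fractions is cross-multiplication, valid since q - 1 is
    nonzero.\<close>
  thus "Fraction_Field.Fract (mary_P m k) 1 =
      Fraction_Field.Fract (ipow 1 ^ (k + 1) - 1) (ipow 1 - 1)"
    using mary_P_geometric[OF assms] ipow_1_neq_1 by (simp add: eq_fract)
next
  fix n :: nat assume "n \<ge> 2"
  thus "mary_P m n =
      ipow 1 ^ (1 + multiplicity m n) * mary_P m (n - 1) + mary_P m (n div m)"
    using assms by (intro mary_P_rec) simp_all
qed

end
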